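(* Let $x\in\mathbb{R}^n$ with $\|x\|_2\le0.5$. Then the linear system $$\nabla^2f(x)\,\Delta x=-\nabla f(x)$$ is well-posed, with condition number $\|\nabla^2f(x)\|_2\,\|(\nabla^2f(x))^{-1}\|_2\le C_{Hf}$, and $\|\nabla f(x)\|_2\le C_{Df}$.
   Context: $n,m\ge1$; $Q\in\mathbb{R}^{n\times n}$ symmetric positive semidefinite, $c\in\mathbb{R}^n$, $A\in\mathbb{R}^{m\times n}$, $b\in\mathbb{R}^m$, $\mathrm{tol}>0$; $q(x)=\frac12x^{\mathsf T}Qx+c^{\mathsf T}x$; $\|\cdot\|_2$ is the Euclidean/spectral norm. Well-posed means that the matrix is invertible. Parameters: positive reals with $C_{Hf}\ge10$; $C_q\ge\|Q\|_2n+\|c\|_2\sqrt n$; $\omega\le\min\{\frac{\mathrm{tol}}{2n},\frac{\mathrm{tol}^2}{16(4C_q+n)},1\}$; $\tau_A\ge\max\{\frac14\|Q+\omega I+\frac1\omega A^{\mathsf T}A\|_2,4\|c-\frac1\omega A^{\mathsf T}b\|_2\}$; and $$C_{Df}:=\frac1{\tau_A}\Big(\omega+\|Q\|_2+\frac1\omega\big(\|A\|_2^2+\|b\|_2\big)\Big)+4\sqrt n.$$ The function $f$ is, for $\|x\|_\infty<1$, $$f(x)=\frac1{\tau_A}\Big(q(x)+\frac\omega2\|x\|_2^2+\frac1{2\omega}\|Ax-b\|_2^2\Big)-\sum_{j=1}^n\big(\log(1+x^{[j]})+\log(1-x^{[j]})\big).$$ *)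

theory Defs
  imports "HOL-Analysis.Analysis"
begin

text \<open>The library norm on \<^typ>\<open>real^'n^'m\<close> is the Frobenius norm, so the spectral norm has to be
  taken as the operator norm with respect to the Euclidean vector norms.\<close>

definition spectral_norm :: "real^'n^'m \<Rightarrow> real" where
  "spectral_norm M = onorm (\<lambda>v. M *v v)"

definition condition_number :: "real^'n^'n \<Rightarrow> real" where
  "condition_number M = spectral_norm M * spectral_norm (matrix_inv M)"

definition symmetric_psd :: "real^'n^'n \<Rightarrow> bool" where
  "symmetric_psd M \<longleftrightarrow> transpose M = M \<and> (\<forall>v. 0 \<le> v \<bullet> (M *v v))"

definition gradient :: "(real^'n \<Rightarrow> real) \<Rightarrow> real^'n \<Rightarrow> real^'n" where
  "gradient f x = (THE g. GDERIV f x :> g)"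

definition hessian :: "(real^'n \<Rightarrow> real) \<Rightarrow> real^'n \<Rightarrow> real^'n^'n" where
  "hessian f x = jacobian (gradient f) (at x)"

lemma gradientI: "GDERIV f x :> g \<Longrightarrow> gradient f x = g"
  unfolding gradient_def
proof (rule the_equality)
  fix g' assume "GDERIV f x :> g" and "GDERIV f x :> g'"
  then have "(\<lambda>h. h \<bullet> g') = (\<lambda>h. h \<bullet> g)"
    unfolding gderiv_def by (rule has_derivative_unique[rotated])
  then have "\<And>h. h \<bullet> g' = h \<bullet> g" by (rule fun_cong)
  then show "g' = g" by (rule vector_eq_ldot[THEN iffD1, OF allI])
qed

lemma hessianI:
  "(gradient f has_derivative (\<lambda>h. H *v h)) (at x) \<Longrightarrow> hessian f x = H"
  using frechet_derivative_at[of "gradient f" "\<lambda>h. H *v h" x]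
  by (metis hessian_def jacobian_def matrix_of_matrix_vector_mul)

definition quad_obj :: "real^'n^'n \<Rightarrow> real^'n \<Rightarrow> real^'n \<Rightarrow> real" where
  "quad_obj Q c x = 1/2 * (x \<bullet> (Q *v x)) + c \<bullet> x"

text \<open>The barrier function is meant on the open cube of sup-norm less than 1; elsewhere its value
  is an artefact of the totality of \<^const>\<open>ln\<close>. Since the cube is open, derivatives at its points
  do not depend on these values.\<close>

definition barrier_fun ::
  "real^'n^'n \<Rightarrow> real^'n \<Rightarrow> real^'n^'m \<Rightarrow> real^'m \<Rightarrow> real \<Rightarrow> real \<Rightarrow> real^'n \<Rightarrow> real" where
  "barrier_fun Q c A b \<omega> \<tau> x =
     1/\<tau> * (quad_obj Q c x + \<omega>/2 * (norm x)\<^sup>2 + 1/(2*\<omega>) * (norm (A *v x - b))\<^sup>2)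
     - (\<Sum>j\<in>UNIV. ln (1 + x $ j) + ln (1 - x $ j))"

definition C_Df :: "real^'n^'n \<Rightarrow> real^'n^'m \<Rightarrow> real^'m \<Rightarrow> real \<Rightarrow> real \<Rightarrow> real" where
  "C_Df Q A b \<omega> \<tau> =
     1/\<tau> * (\<omega> + spectral_norm Q + 1/\<omega> * ((spectral_norm A)\<^sup>2 + norm b))
     + 4 * sqrt (real CARD('n))"

end

theory Submission
  imports Defs
begin

text \<open>The barrier function splits as \<open>f y = 1/\<tau> * (1/2 * y \<bullet> M y + d \<bullet> y) + const + \<Phi> y\<close>, where
  \<open>M = Q + \<omega> I + (1/\<omega>) A\<^sup>T A\<close> is symmetric positive semidefinite,
  \<open>d = c - (1/\<omega>) A\<^sup>T b\<close>, and \<open>\<Phi>\<close> is the sum of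
  \<open>- ln (1 + t) - ln (1 - t)\<close> over the coordinates \<open>t\<close> of \<open>y\<close>. On the open cube the latter has
  first derivative \<open>2 t / (1 - t\<^sup>2)\<close> and second derivative
  \<open>2 (1 + t\<^sup>2) / (1 - t\<^sup>2)\<^sup>2\<close>. Thus the Hessian is \<open>M / \<tau> + D\<close> with \<open>D\<close> diagonal.

  If the Euclidean norm of \<open>x\<close> is at most \<open>1/2\<close>, then so is every coordinate in absolute value,
  and the entries of \<open>D\<close> lie in the interval from \<open>2\<close> to \<open>40/9\<close>. The choice of \<open>\<tau>\<close>
  gives \<open>\<parallel>M / \<tau>\<parallel> \<le> 4\<close>, so the Hessian has spectral norm at most \<open>4 + 40/9 = 76/9\<close>; since it
  is bounded below by \<open>2\<close> as a quadratic form, it is invertible with inverse of norm at most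
  \<open>1/2\<close>. The condition number is therefore at most \<open>38/9 \<le> 10\<close>. The gradient
  \<open>(M x + d) / \<tau> + \<nabla>\<Phi> x\<close> has norm at most \<open>4 * 1/2 + 1/4 + 4/3 \<le> 4\<close>, which is already
  covered by the term \<open>4 * sqrt n\<close> of the bound.\<close>

section \<open>Spectral norms and positive definite matrices\<close>

lemma norm_matrix_vector_le_spectral_norm: "norm (M *v v) \<le> spectral_norm M * norm v"
  for M :: "real^'n^'m"
  unfolding spectral_norm_def by (rule onorm) simp

lemma spectral_norm_nonneg: "0 \<le> spectral_norm M"
  for M :: "real^'n^'m"
  unfolding spectral_norm_def by (rule onorm_pos_le) simp

lemma spectral_norm_le:
  fixes M :: "real^'n^'m"
  assumes "\<And>v. norm (M *v v) \<le> k * norm v"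
  shows "spectral_norm M \<le> k"
  unfolding spectral_norm_def using assms by (rule onorm_le)

text \<open>Coercivity of the quadratic form gives \<open>norm (M *v v) \<ge> k * norm v\<close> by the
  Cauchy--Schwarz inequality, hence injectivity and the bound on the inverse. No symmetry is
  needed.\<close>

lemma coercive_matrix_inverse:
  fixes M :: "real^'n^'n"
  assumes "k > 0" and coercive: "\<And>v. k * (norm v)\<^sup>2 \<le> v \<bullet> (M *v v)"
  shows "invertible M" and "spectral_norm (matrix_inv M) \<le> 1 / k"
proof -
  have lower: "k * norm v \<le> norm (M *v v)" for v
  proof (cases "v = 0")
    case False
    have "norm v * (k * norm v) \<le> norm v * norm (M *v v)"
      using coercive[of v] norm_cauchy_schwarz[of v "M *v v"]
      by (simp add: power2_eq_square mult.left_commute)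
    with False show ?thesis by simp
  qed simp
  have "v = 0" if "M *v v = 0" for v
    using lower[of v] that \<open>k > 0\<close> by (simp add: mult_le_0_iff)
  then show inv: "invertible M"
    by (auto simp: invertible_left_inverse matrix_left_invertible_ker)
  have right_inv: "M ** matrix_inv M = mat 1"
    unfolding matrix_inv_def
    by (rule someI2_ex) (use inv in \<open>auto simp: invertible_def\<close>)
  show "spectral_norm (matrix_inv M) \<le> 1 / k"
  proof (rule spectral_norm_le)
    fix w
    have "M *v (matrix_inv M *v w) = w"
      by (simp add: matrix_vector_mul_assoc right_inv)
    then show "norm (matrix_inv M *v w) \<le> 1 / k * norm w"
      using lower[of "matrix_inv M *v w"] \<open>k > 0\<close> by (simp add: field_simps)
  qed
qed

text \<open>The diagonal matrix with diagonal \<open>d\<close>.\<close>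

definition diag_matrix :: "real^'n \<Rightarrow> real^'n^'n" where
  "diag_matrix d = (\<chi> i j. if i = j then d $ i else 0)"

lemma diag_matrix_mult_vector: "diag_matrix d *v v = (\<chi> i. d $ i * v $ i)"
  by (simp add: diag_matrix_def matrix_vector_mult_def vec_eq_iff if_distrib[of "\<lambda>a. a * _"]
      cong: if_cong)

lemma norm_vec_le_scaled:
  fixes v w :: "real^'n"
  assumes "0 \<le> k" and "\<And>i. \<bar>v $ i\<bar> \<le> k * \<bar>w $ i\<bar>"
  shows "norm v \<le> k * norm w"
proof -
  have "norm v \<le> norm (k *\<^sub>R w)"
    by (rule norm_le_componentwise_cart) (use assms in \<open>simp add: abs_mult\<close>)
  then show ?thesis using \<open>0 \<le> k\<close> by simp
qed

lemma inner_diag_matrix_ge: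
  fixes v d :: "real^'n"
  assumes "\<And>i. k \<le> d $ i"
  shows "k * (norm v)\<^sup>2 \<le> v \<bullet> (diag_matrix d *v v)"
proof -
  have "k * (norm v)\<^sup>2 = (\<Sum>i\<in>UNIV. k * (v $ i)\<^sup>2)"
    unfolding power2_norm_eq_inner inner_vec_def by (simp add: power2_eq_square sum_distrib_left)
  also have "\<dots> \<le> (\<Sum>i\<in>UNIV. d $ i * (v $ i)\<^sup>2)"
    by (intro sum_mono mult_right_mono assms) simp
  also have "\<dots> = v \<bullet> (diag_matrix d *v v)"
    by (simp add: diag_matrix_mult_vector inner_vec_def power2_eq_square mult_ac)
  finally show ?thesis .
qed

lemma inner_symmetric_matrix:
  fixes M :: "real^'n^'n"
  assumes "transpose M = M"
  shows "v \<bullet> (M *v w) = w \<bullet> (M *v v)"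
  using assms by (metis dot_lmul_matrix inner_commute transpose_matrix_vector)

section \<open>The quadratic part\<close>

text \<open>Expanding the squared residual turns the smooth part of the barrier function into a single
  quadratic function, with the following matrix and linear coefficient.\<close>

definition reg_matrix :: "real^'n^'n \<Rightarrow> real^'n^'m \<Rightarrow> real \<Rightarrow> real^'n^'n" where
  "reg_matrix Q A \<omega> = Q + \<omega> *\<^sub>R mat 1 + (1/\<omega>) *\<^sub>R (transpose A ** A)"

definition reg_vector :: "real^'n \<Rightarrow> real^'n^'m \<Rightarrow> real^'m \<Rightarrow> real \<Rightarrow> real^'n" where
  "reg_vector c A b \<omega> = c - (1/\<omega>) *\<^sub>R (transpose A *v b)"

lemma inner_transpose_mult: "v \<bullet> (transpose A *v w) = (A *v v) \<bullet> w"
  for A :: "real^'n^'m"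
  by (metis dot_lmul_matrix inner_commute transpose_matrix_vector)

lemma reg_matrix_mult_vector:
  "reg_matrix Q A \<omega> *v v = Q *v v + \<omega> *\<^sub>R v + (1/\<omega>) *\<^sub>R (transpose A *v (A *v v))"
  by (simp add: reg_matrix_def matrix_vector_mult_add_rdistrib matrix_vector_mul_assoc
      flip: scaleR_matrix_vector_assoc del: transpose_matrix_vector)

lemma inner_reg_matrix:
  "v \<bullet> (reg_matrix Q A \<omega> *v w) = v \<bullet> (Q *v w) + \<omega> * (v \<bullet> w) + 1/\<omega> * ((A *v v) \<bullet> (A *v w))"
  by (simp add: reg_matrix_mult_vector inner_add_right inner_transpose_mult
      del: transpose_matrix_vector)

lemma symmetric_psd_reg_matrix:
  assumes "symmetric_psd Q" and "\<omega> > 0"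
  shows "symmetric_psd (reg_matrix Q A \<omega>)"
proof -
  have "transpose Q = Q" using assms by (simp add: symmetric_psd_def)
  then have "v \<bullet> (reg_matrix Q A \<omega> *v w) = w \<bullet> (reg_matrix Q A \<omega> *v v)" for v w
    by (simp add: inner_reg_matrix inner_symmetric_matrix[of Q v w] inner_commute)
  then have "v \<bullet> (transpose (reg_matrix Q A \<omega>) *v w) = v \<bullet> (reg_matrix Q A \<omega> *v w)" for v w
    by (simp add: inner_transpose_mult inner_commute del: transpose_matrix_vector)
  then have "transpose (reg_matrix Q A \<omega>) = reg_matrix Q A \<omega>"
    unfolding matrix_eq using vector_eq_rdot by (metis inner_commute)
  moreover have "0 \<le> v \<bullet> (reg_matrix Q A \<omega> *v v)" for v
    using assms by (simp add: inner_reg_matrix symmetric_psd_def)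
  ultimately show ?thesis by (simp add: symmetric_psd_def)
qed

lemma regularised_objective_eq:
  assumes "\<omega> > 0"
  shows "quad_obj Q c y + \<omega>/2 * (norm y)\<^sup>2 + 1/(2*\<omega>) * (norm (A *v y - b))\<^sup>2
    = quad_obj (reg_matrix Q A \<omega>) (reg_vector c A b \<omega>) y + 1/(2*\<omega>) * (norm b)\<^sup>2"
proof -
  have "(norm (A *v y - b))\<^sup>2 = (A *v y) \<bullet> (A *v y) - 2 * ((A *v y) \<bullet> b) + (norm b)\<^sup>2"
    by (simp add: power2_norm_eq_inner inner_diff_left inner_diff_right inner_commute)
  moreover have "reg_vector c A b \<omega> \<bullet> y = c \<bullet> y - 1/\<omega> * ((A *v y) \<bullet> b)"
    using inner_transpose_mult[of y A b]
    by (simp add: reg_vector_def inner_diff_left inner_commute[of _ y] inner_commute[of b]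
        inner_diff_right del: transpose_matrix_vector)
  ultimately show ?thesis
    using assms by (simp add: quad_obj_def inner_reg_matrix power2_norm_eq_inner field_simps)
qed

lemma GDERIV_quad_obj:
  assumes "transpose M = M"
  shows "GDERIV (quad_obj M d) y :> M *v y + d"
proof -
  have *: "((*v) M has_derivative (*v) M) (at y)"
    by (rule bounded_linear_imp_has_derivative) simp
  show ?thesis
    unfolding gderiv_def quad_obj_def
    by (rule derivative_eq_intros * refl)+
      (auto simp: inner_add_right inner_symmetric_matrix[OF assms, of y] inner_commute)
qed

section \<open>Gradient and Hessian of the barrier function\<close>

text \<open>The gradient and the Hessian, on the open cube, of
  \<open>1/\<tau> * quad_obj M d y - (\<Sum>j\<in>UNIV. ln (1 + y $ j) + ln (1 - y $ j))\<close> for symmetric \<open>M\<close>, given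
  by their formulas.\<close>

definition barrier_grad ::
  "real^'n^'n \<Rightarrow> real^'n \<Rightarrow> real \<Rightarrow> real^'n \<Rightarrow> real^'n" where
  "barrier_grad M d \<tau> y = (1/\<tau>) *\<^sub>R (M *v y + d) + (\<chi> j. 2 * y $ j / (1 - (y $ j)\<^sup>2))"

definition barrier_hess :: "real^'n^'n \<Rightarrow> real \<Rightarrow> real^'n \<Rightarrow> real^'n^'n" where
  "barrier_hess M \<tau> y =
     (1/\<tau>) *\<^sub>R M + diag_matrix (\<chi> j. 2 * (1 + (y $ j)\<^sup>2) / (1 - (y $ j)\<^sup>2)\<^sup>2)"

lemma barrier_hess_mult_vector:
  "barrier_hess M \<tau> y *v v = (1/\<tau>) *\<^sub>R (M *v v)
    + diag_matrix (\<chi> j. 2 * (1 + (y $ j)\<^sup>2) / (1 - (y $ j)\<^sup>2)\<^sup>2) *v v"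
  by (simp add: barrier_hess_def matrix_vector_mult_add_rdistrib flip: scaleR_matrix_vector_assoc)

lemma GDERIV_log_barrier:
  fixes y :: "real^'n"
  assumes "\<And>j. \<bar>y $ j\<bar> < 1"
  shows "GDERIV (\<lambda>y. \<Sum>j\<in>UNIV. ln (1 + y $ j) + ln (1 - y $ j)) y
           :> - (\<chi> j. 2 * y $ j / (1 - (y $ j)\<^sup>2))"
proof -
  have coord: "((\<lambda>y. ln (1 + y $ j) + ln (1 - y $ j)) has_derivative
      (\<lambda>h. - (2 * y $ j / (1 - (y $ j)\<^sup>2)) * h $ j)) (at y)" for j :: 'n
  proof (rule DERIV_compose_FDERIV[where g = "\<lambda>y. y $ j", THEN has_derivative_eq_rhs])
    have ne: "1 + y $ j > 0" "1 - y $ j > 0" using assms[of j] by auto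
    have "1 - (y $ j)\<^sup>2 = (1 + y $ j) * (1 - y $ j)"
      by (simp add: power2_eq_square algebra_simps)
    with ne show "((\<lambda>t. ln (1 + t) + ln (1 - t)) has_field_derivative
        - (2 * y $ j / (1 - (y $ j)\<^sup>2))) (at (y $ j))"
      by (auto intro!: derivative_eq_intros simp: field_simps)
    show "((\<lambda>y. y $ j) has_derivative (\<lambda>h. h $ j)) (at y)"
      by (rule bounded_linear_imp_has_derivative) (rule bounded_linear_vec_nth)
  qed (auto simp: mult_ac)
  show ?thesis
    unfolding gderiv_def
    by (rule has_derivative_sum[OF coord, THEN has_derivative_eq_rhs])
      (simp add: inner_vec_def mult_ac)
qed

lemma gradient_barrier_fun:
  fixes y :: "real^'n"
  assumes "symmetric_psd Q" and "\<omega> > 0" and "\<And>j. \<bar>y $ j\<bar> < 1"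
  shows "gradient (barrier_fun Q c A b \<omega> \<tau>) y
    = barrier_grad (reg_matrix Q A \<omega>) (reg_vector c A b \<omega>) \<tau> y"
proof (rule gradientI)
  let ?M = "reg_matrix Q A \<omega>" and ?d = "reg_vector c A b \<omega>"
  have "transpose ?M = ?M"
    using symmetric_psd_reg_matrix[OF assms(1,2), of A] by (simp add: symmetric_psd_def)
  note quad = GDERIV_quad_obj[OF this, of ?d y]
  have "barrier_fun Q c A b \<omega> \<tau> = (\<lambda>y. 1/\<tau> * (quad_obj ?M ?d y + 1/(2*\<omega>) * (norm b)\<^sup>2)
      - (\<Sum>j\<in>UNIV. ln (1 + y $ j) + ln (1 - y $ j)))"
    unfolding barrier_fun_def[abs_def] regularised_objective_eq[OF \<open>\<omega> > 0\<close>] ..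
  then show "GDERIV (barrier_fun Q c A b \<omega> \<tau>) y :> barrier_grad ?M ?d \<tau> y"
    using GDERIV_diff[OF GDERIV_mult[OF GDERIV_const[of "1/\<tau>"] GDERIV_add[OF quad GDERIV_const]]
        GDERIV_log_barrier[OF assms(3)]]
    by (simp add: barrier_grad_def)
qed

lemma has_derivative_barrier_grad:
  fixes y :: "real^'n"
  assumes "\<And>j. \<bar>y $ j\<bar> < 1"
  shows "(barrier_grad M d \<tau> has_derivative (*v) (barrier_hess M \<tau> y)) (at y)"
proof -
  let ?g = "\<lambda>t::real. 2 * t / (1 - t\<^sup>2)"
  let ?g' = "\<lambda>t::real. 2 * (1 + t\<^sup>2) / (1 - t\<^sup>2)\<^sup>2"
  have coord: "((\<lambda>y. ?g (y $ j)) has_derivative (\<lambda>h. ?g' (y $ j) * h $ j)) (at y)" for j :: 'n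
  proof (rule DERIV_compose_FDERIV[where g = "\<lambda>y. y $ j", THEN has_derivative_eq_rhs])
    have "(y $ j)\<^sup>2 < 1" using assms[of j] by (simp add: abs_square_less_1)
    then show "(?g has_field_derivative ?g' (y $ j)) (at (y $ j))"
      by (auto intro!: derivative_eq_intros simp: power2_eq_square algebra_simps)
    show "((\<lambda>y. y $ j) has_derivative (\<lambda>h. h $ j)) (at y)"
      by (rule bounded_linear_imp_has_derivative) (rule bounded_linear_vec_nth)
  qed (auto simp: mult_ac)
  have diag: "((\<lambda>y. \<chi> j. ?g (y $ j)) has_derivative (*v) (diag_matrix (\<chi> j. ?g' (y $ j)))) (at y)"
    by (subst has_derivative_componentwise_within)
      (auto simp: Basis_vec_def inner_axis diag_matrix_mult_vector intro!: coord[simplified])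
  have lin: "((*v) M has_derivative (*v) M) (at y)"
    by (rule bounded_linear_imp_has_derivative) simp
  have "((\<lambda>y. (1/\<tau>) *\<^sub>R (M *v y + d) + (\<chi> j. ?g (y $ j))) has_derivative
      (\<lambda>h. (1/\<tau>) *\<^sub>R (M *v h + 0) + diag_matrix (\<chi> j. ?g' (y $ j)) *v h)) (at y)"
    by (intro has_derivative_add has_derivative_scaleR_right lin diag has_derivative_const)
  moreover have "(*v) (barrier_hess M \<tau> y)
      = (\<lambda>h. (1/\<tau>) *\<^sub>R (M *v h + 0) + diag_matrix (\<chi> j. ?g' (y $ j)) *v h)"
    by (rule ext) (simp only: barrier_hess_mult_vector add_0_right)
  ultimately show ?thesis
    by (simp only: barrier_grad_def[abs_def])
qed

text \<open>The explicit formula for the gradient holds throughout the open cube, so it may be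
  differentiated there.\<close>

lemma hessian_barrier_fun:
  fixes y :: "real^'n"
  assumes "symmetric_psd Q" and "\<omega> > 0" and "\<And>j. \<bar>y $ j\<bar> < 1"
  shows "hessian (barrier_fun Q c A b \<omega> \<tau>) y = barrier_hess (reg_matrix Q A \<omega>) \<tau> y"
proof (rule hessianI)
  let ?cube = "{z :: real^'n. \<forall>j. \<bar>z $ j\<bar> < 1}"
  have "?cube = (\<Inter>j\<in>UNIV. {z. \<bar>z $ j\<bar> < 1})" by auto
  moreover have "open (\<Inter>j\<in>UNIV. {z :: real^'n. \<bar>z $ j\<bar> < 1})"
    by (intro open_INT ballI open_Collect_less continuous_intros) simp
  ultimately have "open ?cube" by simp
  with has_derivative_barrier_grad[OF assms(3)]
  show "(gradient (barrier_fun Q c A b \<omega> \<tau>) has_derivative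
      (*v) (barrier_hess (reg_matrix Q A \<omega>) \<tau> y)) (at y)"
    by (rule has_derivative_transform_within_open)
      (use assms in \<open>auto simp: gradient_barrier_fun\<close>)
qed

section \<open>Bounds near the origin\<close>

lemma barrier_derivative_bounds:
  fixes t :: real
  assumes "\<bar>t\<bar> \<le> 1/2"
  shows "\<bar>2 * t / (1 - t\<^sup>2)\<bar> \<le> 8/3 * \<bar>t\<bar>"
    and "2 \<le> 2 * (1 + t\<^sup>2) / (1 - t\<^sup>2)\<^sup>2"
    and "2 * (1 + t\<^sup>2) / (1 - t\<^sup>2)\<^sup>2 \<le> 40/9"
proof -
  have "\<bar>t\<bar>\<^sup>2 \<le> (1/2)\<^sup>2" using assms by (intro power_mono) auto
  then have sq: "3/4 \<le> 1 - t\<^sup>2" by (simp add: power2_eq_square)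
  have "\<bar>2 * t / (1 - t\<^sup>2)\<bar> = 2 * \<bar>t\<bar> / (1 - t\<^sup>2)"
    using sq by (simp add: abs_mult)
  also have "\<dots> \<le> 2 * \<bar>t\<bar> / (3/4)"
    using sq by (intro divide_left_mono) auto
  finally show "\<bar>2 * t / (1 - t\<^sup>2)\<bar> \<le> 8/3 * \<bar>t\<bar>" by simp
  have "(1 - t\<^sup>2)\<^sup>2 \<le> 1\<^sup>2" using sq by (intro power_mono) auto
  then have "(1 - t\<^sup>2)\<^sup>2 \<le> 1 + t\<^sup>2" using zero_le_power2[of t] unfolding one_power2 by linarith
  then show "2 \<le> 2 * (1 + t\<^sup>2) / (1 - t\<^sup>2)\<^sup>2"
    using sq by (simp add: pos_le_divide_eq)
  have "(3/4)\<^sup>2 \<le> (1 - t\<^sup>2)\<^sup>2" using sq by (intro power_mono) auto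
  then have "2 * (1 + t\<^sup>2) / (1 - t\<^sup>2)\<^sup>2 \<le> (5/2) / (3/4)\<^sup>2"
    using sq by (intro frac_le) auto
  then show "2 * (1 + t\<^sup>2) / (1 - t\<^sup>2)\<^sup>2 \<le> 40/9" by (simp add: power2_eq_square)
qed

lemma barrier_hess_bounds:
  fixes x :: "real^'n"
  assumes "symmetric_psd M" and "\<tau> > 0" and "spectral_norm M \<le> 4 * \<tau>" and "norm x \<le> 1/2"
  shows "invertible (barrier_hess M \<tau> x)" and "condition_number (barrier_hess M \<tau> x) \<le> 10"
proof -
  let ?d = "\<chi> j. 2 * (1 + (x $ j)\<^sup>2) / (1 - (x $ j)\<^sup>2)\<^sup>2"
  let ?H = "barrier_hess M \<tau> x"
  have "\<bar>x $ j\<bar> \<le> 1/2" for j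
    using component_le_norm_cart[of x j] assms(4) by linarith
  then have d: "2 \<le> ?d $ j" "?d $ j \<le> 40/9" for j
    using barrier_derivative_bounds(2,3)[of "x $ j"] by auto
  have H_mult: "?H *v v = (1/\<tau>) *\<^sub>R (M *v v) + diag_matrix ?d *v v" for v
    by (rule barrier_hess_mult_vector)
  have coercive: "2 * (norm v)\<^sup>2 \<le> v \<bullet> (?H *v v)" for v
  proof -
    have "0 \<le> (1/\<tau>) * (v \<bullet> (M *v v))"
      using assms(1,2) by (simp add: symmetric_psd_def)
    then show ?thesis
      using inner_diag_matrix_ge[of 2 ?d v, OF d(1)] unfolding H_mult by (simp add: inner_add_right)
  qed
  have "norm (?H *v v) \<le> 76/9 * norm v" for v
  proof -
    have "norm (M *v v) \<le> 4 * \<tau> * norm v"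
      using norm_matrix_vector_le_spectral_norm[of M v] assms(3)
      by (meson mult_right_mono norm_ge_zero order_trans)
    then have M: "norm ((1/\<tau>) *\<^sub>R (M *v v)) \<le> 4 * norm v"
      using \<open>\<tau> > 0\<close> by (simp add: field_simps)
    have abs_d: "\<bar>?d $ j\<bar> \<le> 40/9" for j using d[of j] by linarith
    have D: "norm (diag_matrix ?d *v v) \<le> 40/9 * norm v"
    proof (rule norm_vec_le_scaled)
      fix j
      have "(diag_matrix ?d *v v) $ j = ?d $ j * v $ j"
        by (simp only: diag_matrix_mult_vector vec_lambda_beta)
      then show "\<bar>(diag_matrix ?d *v v) $ j\<bar> \<le> 40/9 * \<bar>v $ j\<bar>"
        using mult_right_mono[OF abs_d, of "\<bar>v $ j\<bar>" j] by (simp only: abs_mult abs_ge_zero)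
    qed simp
    show ?thesis
      unfolding H_mult using norm_triangle_le[OF add_mono[OF M D]] by simp
  qed
  then have upper: "spectral_norm ?H \<le> 76/9" by (rule spectral_norm_le)
  have two: "(2::real) > 0" by simp
  show "invertible ?H" by (rule coercive_matrix_inverse(1)[OF two coercive])
  have "spectral_norm ?H * spectral_norm (matrix_inv ?H) \<le> 76/9 * (1/2)"
    by (intro mult_mono upper coercive_matrix_inverse(2)[OF two coercive] spectral_norm_nonneg)
      simp
  then show "condition_number ?H \<le> 10" by (simp add: condition_number_def)
qed

lemma norm_barrier_grad_le:
  fixes x :: "real^'n"
  assumes "\<tau> > 0" and "spectral_norm M \<le> 4 * \<tau>" and "4 * norm d \<le> \<tau>" and "norm x \<le> 1/2"
  shows "norm (barrier_grad M d \<tau> x) \<le> 4"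
proof -
  have "norm (M *v x) \<le> (4 * \<tau>) * (1/2)"
    by (rule order_trans[OF norm_matrix_vector_le_spectral_norm])
      (use assms spectral_norm_nonneg[of M] in \<open>intro mult_mono; simp\<close>)
  then have "norm (M *v x + d) \<le> 9/4 * \<tau>"
    using norm_triangle_ineq[of "M *v x" d] assms(3) by linarith
  then have smooth: "norm ((1/\<tau>) *\<^sub>R (M *v x + d)) \<le> 9/4"
    unfolding norm_scaleR using \<open>\<tau> > 0\<close> by (simp add: field_simps)
  have "\<bar>x $ j\<bar> \<le> 1/2" for j
    using component_le_norm_cart[of x j] assms(4) by linarith
  then have "norm (\<chi> j. 2 * x $ j / (1 - (x $ j)\<^sup>2)) \<le> 8/3 * norm x"
    using barrier_derivative_bounds(1) by (intro norm_vec_le_scaled) auto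
  with smooth assms(4) show ?thesis
    unfolding barrier_grad_def by (intro norm_triangle_le) linarith
qed

section \<open>The Newton system\<close>

theorem theorem4p1:
  fixes Q :: "real^'n^'n" and c :: "real^'n"
    and A :: "real^'n^'m" and b :: "real^'m"
    and tol C_Hf C_q \<omega> \<tau>\<^sub>A :: real
    and x :: "real^'n"
  assumes "symmetric_psd Q"
    and "tol > 0"
    and "C_Hf > 0" and "C_q > 0" and "\<omega> > 0" and "\<tau>\<^sub>A > 0"
    and "C_Hf \<ge> 10"
    and "C_q \<ge> spectral_norm Q * real CARD('n) + norm c * sqrt (real CARD('n))"
    and "\<omega> \<le> Min {tol / (2 * real CARD('n)), tol\<^sup>2 / (16 * (4 * C_q + real CARD('n))), 1}"
    and "\<tau>\<^sub>A \<ge> max (1/4 * spectral_norm (Q + \<omega> *\<^sub>R mat 1 + (1/\<omega>) *\<^sub>R (transpose A ** A)))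
                  (4 * norm (c - (1/\<omega>) *\<^sub>R (transpose A *v b)))"
    and "norm x \<le> 0.5"
  shows "invertible (hessian (barrier_fun Q c A b \<omega> \<tau>\<^sub>A) x)
    \<and> condition_number (hessian (barrier_fun Q c A b \<omega> \<tau>\<^sub>A) x) \<le> C_Hf
    \<and> norm (gradient (barrier_fun Q c A b \<omega> \<tau>\<^sub>A) x) \<le> C_Df Q A b \<omega> \<tau>\<^sub>A"
proof -
  let ?M = "reg_matrix Q A \<omega>" and ?d = "reg_vector c A b \<omega>"
  have x: "norm x \<le> 1/2" using assms(11) by simp
  have cube: "\<bar>x $ j\<bar> < 1" for j
    using component_le_norm_cart[of x j] x by linarith
  have M: "spectral_norm ?M \<le> 4 * \<tau>\<^sub>A" and d: "4 * norm ?d \<le> \<tau>\<^sub>A"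
    using assms(10) unfolding reg_matrix_def reg_vector_def by linarith+
  note hess = hessian_barrier_fun[OF assms(1,5) cube, of c A b \<tau>\<^sub>A]
    and grad = gradient_barrier_fun[OF assms(1,5) cube, of c A b \<tau>\<^sub>A]
    and bounds = barrier_hess_bounds[OF symmetric_psd_reg_matrix[OF assms(1,5)] assms(6) M x]
  have "4 \<le> 4 * sqrt (real CARD('n))" by simp
  \<comment> \<open>The other summands of \<open>C_Df\<close> are nonnegative.\<close>
  also have "\<dots> \<le> C_Df Q A b \<omega> \<tau>\<^sub>A"
    using assms(5,6) by (simp add: C_Df_def spectral_norm_nonneg)
  finally have "norm (barrier_grad ?M ?d \<tau>\<^sub>A x) \<le> C_Df Q A b \<omega> \<tau>\<^sub>A"
    using norm_barrier_grad_le[OF assms(6) M d x] by linarith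
  with bounds \<open>C_Hf \<ge> 10\<close> show ?thesis
    unfolding hess grad by auto
qed

end
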